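(* Let $R$ be an integral domain. Then $C^*(R_+)\rtimes R^\times$ is an extension of $\mathcal{Q}((R_+\rtimes R^\times)^{\mathrm{op}})$, i.e. there is a surjective ($*$-)homomorphism $C^*(R_+)\rtimes R^\times\to\mathcal{Q}((R_+\rtimes R^\times)^{\mathrm{op}})$. Moreover, if $R$ is a GCD domain, then $C^*(R_+)\rtimes R^\times\cong\mathcal{Q}((R_+\rtimes R^\times)^{\mathrm{op}})$.
   Context: All rings are assumed countable, unital, with $0\neq1$; all semigroups are assumed discrete, countable, unital and left cancellative. A GCD domain is an integral domain in which any two nonzero elements have a greatest common divisor. Let $R$ be an integral domain. $R_+$ is the additive group $(R,+)$; $R^\times$ is the multiplicative semigroup $(R\setminus\{0\},\cdot)$. Let $\{u_r\}_{r\in R_+}$ be the canonical unitaries generating the group C*-algebra $C^*(R_+)$, and let $\alpha:R^\times\to\mathrm{End}(C^*(R_+))$ be the semigroup homomorphism with $\alpha_p(u_r)=u_{pr}$; each $\alpha_p$ is unital and injective. Semigroup crossed product: for a semigroup $P$, a unital C*-algebra $A$, and a semigroup homomorphism $\alpha:P\to\mathrm{End}(A)$ with every $\alpha_p$ injective, $A\rtimes_\alpha P$ is the universal unital C*-algebra generated by the images of a unital ($*$-)homomorphism $i_A:A\to A\rtimes_\alpha P$ and a semigroup homomorphism $i_P:P\to\mathrm{Isom}(A\rtimes_\alpha P)$ into the isometries such that $i_P(p)i_A(a)i_P(p)^*=i_A(\alpha_p(a))$ for all $p\in P,a\in A$; universality means that for every unital C*-algebra $B$, unital homomorphism $j_A:A\to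 B$ and semigroup homomorphism $j_P:P\to\mathrm{Isom}(B)$ with $j_P(p)j_A(a)j_P(p)^*=j_A(\alpha_p(a))$, there is a unique unital homomorphism $\Phi:A\rtimes_\alpha P\to B$ with $\Phi\circ i_A=j_A$ and $\Phi\circ i_P=j_P$. $C^*(R_+)\rtimes R^\times$ denotes $C^*(R_+)\rtimes_\alpha R^\times$ where $\alpha:R^\times\to\mathrm{End}(C^*(R_+))$ is the semigroup homomorphism with $\alpha_p(u_r)=u_{pr}$ for all $p\in R^\times$, $r\in R_+$. $R_+\rtimes R^\times$ is the $ax+b$-semigroup of $R$: the set $R\times(R\setminus\{0\})$ with multiplication $(r_2,p_2)(r_1,p_1)=(r_2+p_2r_1,p_2p_1)$. $(R_+\rtimes R^\times)^{\mathrm{op}}$ is its opposite semigroup, with multiplication $(r_1,p_1)\times(r_2,p_2)=(r_2,p_2)(r_1,p_1)=(r_2+p_2r_1,p_1p_2)$. Boundary quotient: let $P$ be a semigroup. For $p\in P$ write $p$ also for the left multiplication map $q\mapsto pq$, and for $X\subseteq P$ let $pX$ be the image and $p^{-1}X$ the preimage of $X$ under this map. The set of constructible right ideals is $\mathcal{J}(P):=\{p_1^{-1}q_1\cdots p_n^{-1}q_nP:n\geq1,\ p_1,q_1,\dots,p_n,q_n\in P\}\cup\{\emptyset\}$. A finite subset $F\subset\mathcal{J}(P)$ is a foundation set if for any nonempty $X\in\mathcal{J}(P)$ there exists $Y\in F$ with $X\cap Y\neq\emptyset$. The boundary quotient $\mathcal{Q}(P)$ (of the full semigroup C*-algebra $C^*(P)$)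 is the universal unital C*-algebra generated by isometries $\{v_p\}_{p\in P}$ and projections $\{e_X\}_{X\in\mathcal{J}(P)}$ satisfying: (1) $v_pv_q=v_{pq}$ for all $p,q\in P$; (2) $v_pe_Xv_p^*=e_{pX}$ for all $p\in P$, $X\in\mathcal{J}(P)$; (3) $e_\emptyset=0$ and $e_P=1$; (4) $e_Xe_Y=e_{X\cap Y}$ for all $X,Y\in\mathcal{J}(P)$; and (5) $\prod_{X\in F}(1-e_X)=0$ for every foundation set $F\subset\mathcal{J}(P)$. *)

theory Defs
  imports Complex_Main "HOL-Library.Countable_Set"
    "HOL-Algebra.Module" "HOL-Algebra.Divisibility" "HOL-Algebra.Multiplicative_Group"
begin

section \<open>Unital C*-algebras\<close>

text \<open>
  C*-algebras are records with an explicit carrier, so that one can quantify over all C*-algebras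
  (with carrier in a given type) inside a formula. The zero algebra is allowed: a universal algebra
  given by generators and relations may a priori collapse.
\<close>

record 'a cstar = "(complex, 'a) module" +
  adj :: "'a \<Rightarrow> 'a"
  cnorm :: "'a \<Rightarrow> real"

locale unital_cstar_algebra = ring A for A :: "('a, 'm) cstar_scheme" (structure) +
  assumes smult_closed: "x \<in> carrier A \<Longrightarrow> c \<odot> x \<in> carrier A"
    and smult_l_distr: "x \<in> carrier A \<Longrightarrow> (c + d) \<odot> x = c \<odot> x \<oplus> d \<odot> x"
    and smult_r_distr: "x \<in> carrier A \<Longrightarrow> y \<in> carrier A \<Longrightarrow> c \<odot> (x \<oplus> y) = c \<odot> x \<oplus> c \<odot> y"
    and smult_smult: "x \<in> carrier A \<Longrightarrow> (c * d) \<odot> x = c \<odot> (d \<odot> x)"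
    and smult_one: "x \<in> carrier A \<Longrightarrow> 1 \<odot> x = x"
    and smult_mult_left: "x \<in> carrier A \<Longrightarrow> y \<in> carrier A \<Longrightarrow> (c \<odot> x) \<otimes> y = c \<odot> (x \<otimes> y)"
    and smult_mult_right: "x \<in> carrier A \<Longrightarrow> y \<in> carrier A \<Longrightarrow> x \<otimes> (c \<odot> y) = c \<odot> (x \<otimes> y)"
    and adj_closed: "x \<in> carrier A \<Longrightarrow> adj A x \<in> carrier A"
    and adj_adj: "x \<in> carrier A \<Longrightarrow> adj A (adj A x) = x"
    and adj_add: "x \<in> carrier A \<Longrightarrow> y \<in> carrier A \<Longrightarrow> adj A (x \<oplus> y) = adj A x \<oplus> adj A y"
    and adj_smult: "x \<in> carrier A \<Longrightarrow> adj A (c \<odot> x) = cnj c \<odot> adj A x"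
    and adj_mult: "x \<in> carrier A \<Longrightarrow> y \<in> carrier A \<Longrightarrow> adj A (x \<otimes> y) = adj A y \<otimes> adj A x"
    and cnorm_nonneg: "x \<in> carrier A \<Longrightarrow> 0 \<le> cnorm A x"
    and cnorm_eq_0: "x \<in> carrier A \<Longrightarrow> cnorm A x = 0 \<longleftrightarrow> x = \<zero>"
    and cnorm_triangle: "x \<in> carrier A \<Longrightarrow> y \<in> carrier A \<Longrightarrow> cnorm A (x \<oplus> y) \<le> cnorm A x + cnorm A y"
    and cnorm_smult: "x \<in> carrier A \<Longrightarrow> cnorm A (c \<odot> x) = cmod c * cnorm A x"
    and cnorm_mult: "x \<in> carrier A \<Longrightarrow> y \<in> carrier A \<Longrightarrow> cnorm A (x \<otimes> y) \<le> cnorm A x * cnorm A y"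
    and cstar_identity: "x \<in> carrier A \<Longrightarrow> cnorm A (adj A x \<otimes> x) = (cnorm A x)\<^sup>2"
    and complete:
      "range s \<subseteq> carrier A \<Longrightarrow>
       (\<forall>\<epsilon>>0. \<exists>N. \<forall>m\<ge>N. \<forall>n\<ge>N. cnorm A (s m \<ominus> s n) < \<epsilon>) \<Longrightarrow>
       \<exists>x\<in>carrier A. (\<lambda>n. cnorm A (s n \<ominus> x)) \<longlonglongrightarrow> 0"

definition star_hom :: "('a, 'm) cstar_scheme \<Rightarrow> ('b, 'n) cstar_scheme \<Rightarrow> ('a \<Rightarrow> 'b) \<Rightarrow> bool" where
  "star_hom A B f \<longleftrightarrow>
     f \<in> carrier A \<rightarrow> carrier B \<and>
     (\<forall>x\<in>carrier A. \<forall>y\<in>carrier A. f (x \<oplus>\<^bsub>A\<^esub> y) = f x \<oplus>\<^bsub>B\<^esub> f y) \<and>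
     (\<forall>x\<in>carrier A. \<forall>y\<in>carrier A. f (x \<otimes>\<^bsub>A\<^esub> y) = f x \<otimes>\<^bsub>B\<^esub> f y) \<and>
     (\<forall>c. \<forall>x\<in>carrier A. f (c \<odot>\<^bsub>A\<^esub> x) = c \<odot>\<^bsub>B\<^esub> f x) \<and>
     (\<forall>x\<in>carrier A. f (adj A x) = adj B (f x))"

definition unital_star_hom :: "('a, 'm) cstar_scheme \<Rightarrow> ('b, 'n) cstar_scheme \<Rightarrow> ('a \<Rightarrow> 'b) \<Rightarrow> bool" where
  "unital_star_hom A B f \<longleftrightarrow> star_hom A B f \<and> f \<one>\<^bsub>A\<^esub> = \<one>\<^bsub>B\<^esub>"

definition cstar_isomorphic :: "('a, 'm) cstar_scheme \<Rightarrow> ('b, 'n) cstar_scheme \<Rightarrow> bool" where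
  "cstar_isomorphic A B \<longleftrightarrow> (\<exists>f. unital_star_hom A B f \<and> bij_betw f (carrier A) (carrier B))"

definition isometries :: "('a, 'm) cstar_scheme \<Rightarrow> 'a set" where
  "isometries A = {x \<in> carrier A. adj A x \<otimes>\<^bsub>A\<^esub> x = \<one>\<^bsub>A\<^esub>}"

definition unitaries :: "('a, 'm) cstar_scheme \<Rightarrow> 'a set" where
  "unitaries A = {x \<in> carrier A. adj A x \<otimes>\<^bsub>A\<^esub> x = \<one>\<^bsub>A\<^esub> \<and> x \<otimes>\<^bsub>A\<^esub> adj A x = \<one>\<^bsub>A\<^esub>}"

definition projections :: "('a, 'm) cstar_scheme \<Rightarrow> 'a set" where
  "projections A = {x \<in> carrier A. adj A x = x \<and> x \<otimes>\<^bsub>A\<^esub> x = x}"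

definition unital_cstar_subalgebra :: "('a, 'm) cstar_scheme \<Rightarrow> 'a set \<Rightarrow> bool" where
  "unital_cstar_subalgebra A D \<longleftrightarrow>
     D \<subseteq> carrier A \<and> \<one>\<^bsub>A\<^esub> \<in> D \<and>
     (\<forall>x\<in>D. \<forall>y\<in>D. x \<oplus>\<^bsub>A\<^esub> y \<in> D \<and> x \<otimes>\<^bsub>A\<^esub> y \<in> D) \<and>
     (\<forall>c. \<forall>x\<in>D. c \<odot>\<^bsub>A\<^esub> x \<in> D) \<and> (\<forall>x\<in>D. adj A x \<in> D) \<and>
     (\<forall>s. \<forall>x\<in>carrier A. range s \<subseteq> D \<longrightarrow> (\<lambda>n. cnorm A (s n \<ominus>\<^bsub>A\<^esub> x)) \<longlonglongrightarrow> 0 \<longrightarrow> x \<in> D)"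

definition generated_cstar :: "('a, 'm) cstar_scheme \<Rightarrow> 'a set \<Rightarrow> 'a set" where
  "generated_cstar A S = \<Inter>{D. unital_cstar_subalgebra A D \<and> S \<subseteq> D}"


section \<open>Universal C*-algebras\<close>

text \<open>
  In the three definitions below the universal property is tested against all unital C*-algebras
  with carrier in the same type as the universal algebra. If that type has at least the
  cardinality of the continuum (automatic as soon as it carries a nonzero C*-algebra), this is the
  universal property against all unital C*-algebras: in the cases at hand (countable groups,
  semigroups and rings) the images of the generators lie in a separable C*-subalgebra of the test
  algebra, which has at most continuum many elements. A smaller type carries only the zero algebra.

  Morphisms are taken in \<^const>\<open>extensional\<close>, that is, uniqueness is uniqueness on the carrier.
\<close>

definition group_cstar_algebra ::
    "('g, 'm) monoid_scheme \<Rightarrow> 'c cstar \<Rightarrow> ('g \<Rightarrow> 'c) \<Rightarrow> bool" where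
  "group_cstar_algebra G A u \<longleftrightarrow>
     unital_cstar_algebra A \<and>
     u \<in> hom G A \<and> u ` carrier G \<subseteq> unitaries A \<and>
     generated_cstar A (u ` carrier G) = carrier A \<and>
     (\<forall>B :: 'c cstar. \<forall>w. unital_cstar_algebra B \<and> w \<in> hom G B \<and> w ` carrier G \<subseteq> unitaries B \<longrightarrow>
        (\<exists>!\<Phi>. \<Phi> \<in> extensional (carrier A) \<and> unital_star_hom A B \<Phi> \<and>
               (\<forall>g\<in>carrier G. \<Phi> (u g) = w g)))"

definition endo_action ::
    "('p, 'm) monoid_scheme \<Rightarrow> ('a, 'n) cstar_scheme \<Rightarrow> ('p \<Rightarrow> 'a \<Rightarrow> 'a) \<Rightarrow> bool" where
  "endo_action P A \<alpha> \<longleftrightarrow>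
     (\<forall>p\<in>carrier P. star_hom A A (\<alpha> p)) \<and>
     (\<forall>p\<in>carrier P. \<forall>q\<in>carrier P. \<forall>a\<in>carrier A. \<alpha> (p \<otimes>\<^bsub>P\<^esub> q) a = \<alpha> p (\<alpha> q a)) \<and>
     (\<forall>a\<in>carrier A. \<alpha> \<one>\<^bsub>P\<^esub> a = a)"

definition covariant_pair ::
    "('p, 'm) monoid_scheme \<Rightarrow> 'c cstar \<Rightarrow> ('p \<Rightarrow> 'c \<Rightarrow> 'c) \<Rightarrow>
     'c cstar \<Rightarrow> ('c \<Rightarrow> 'c) \<Rightarrow> ('p \<Rightarrow> 'c) \<Rightarrow> bool" where
  "covariant_pair P A \<alpha> B jA jP \<longleftrightarrow>
     unital_star_hom A B jA \<and>
     jP \<in> hom P B \<and> jP \<one>\<^bsub>P\<^esub> = \<one>\<^bsub>B\<^esub> \<and> jP ` carrier P \<subseteq> isometries B \<and>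
     (\<forall>p\<in>carrier P. \<forall>a\<in>carrier A. jP p \<otimes>\<^bsub>B\<^esub> jA a \<otimes>\<^bsub>B\<^esub> adj B (jP p) = jA (\<alpha> p a))"

text \<open>
  \<open>U\<close> with \<open>iA\<close>, \<open>iP\<close> is the semigroup crossed product of \<open>A\<close> by the action \<open>\<alpha>\<close> of \<open>P\<close>.
  Injectivity of the \<open>\<alpha> p\<close> plays no role in the universal property and is not demanded.
\<close>

definition crossed_product ::
    "('p, 'm) monoid_scheme \<Rightarrow> 'c cstar \<Rightarrow> ('p \<Rightarrow> 'c \<Rightarrow> 'c) \<Rightarrow>
     'c cstar \<Rightarrow> ('c \<Rightarrow> 'c) \<Rightarrow> ('p \<Rightarrow> 'c) \<Rightarrow> bool" where
  "crossed_product P A \<alpha> U iA iP \<longleftrightarrow>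
     unital_cstar_algebra U \<and>
     covariant_pair P A \<alpha> U iA iP \<and>
     generated_cstar U (iA ` carrier A \<union> iP ` carrier P) = carrier U \<and>
     (\<forall>B jA jP. unital_cstar_algebra B \<and> covariant_pair P A \<alpha> B jA jP \<longrightarrow>
        (\<exists>!\<Phi>. \<Phi> \<in> extensional (carrier U) \<and> unital_star_hom U B \<Phi> \<and>
               (\<forall>a\<in>carrier A. \<Phi> (iA a) = jA a) \<and> (\<forall>p\<in>carrier P. \<Phi> (iP p) = jP p)))"


section \<open>Constructible right ideals and the boundary quotient\<close>

definition left_preimage :: "('p, 'm) monoid_scheme \<Rightarrow> 'p \<Rightarrow> 'p set \<Rightarrow> 'p set" where
  "left_preimage P p I = {q \<in> carrier P. p \<otimes>\<^bsub>P\<^esub> q \<in> I}"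

text \<open>The list \<open>[(p1, q1), \<dots>, (pn, qn)]\<close> encodes the ideal \<open>p1\<^sup>-\<^sup>1 q1 \<dots> pn\<^sup>-\<^sup>1 qn P\<close>.\<close>

definition constructible_ideals :: "('p, 'm) monoid_scheme \<Rightarrow> 'p set set" where
  "constructible_ideals P =
     {foldr (\<lambda>(p, q) I. left_preimage P p (q <#\<^bsub>P\<^esub> I)) w (carrier P) | w.
        w \<noteq> [] \<and> set w \<subseteq> carrier P \<times> carrier P} \<union> {{}}"

definition foundation_set :: "('p, 'm) monoid_scheme \<Rightarrow> 'p set set \<Rightarrow> bool" where
  "foundation_set P F \<longleftrightarrow>
     finite F \<and> F \<subseteq> constructible_ideals P \<and>
     (\<forall>I\<in>constructible_ideals P. I \<noteq> {} \<longrightarrow> (\<exists>J\<in>F. I \<inter> J \<noteq> {}))"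

text \<open>
  The constructible right ideals are closed under intersection, so \<open>e (I \<inter> J)\<close> is meaningful.
  By the fourth relation the factors of the product in the last one commute; it is
  written as a product along an arbitrary enumeration of the foundation set.
\<close>

definition boundary_relations ::
    "('p, 'm) monoid_scheme \<Rightarrow> ('a, 'n) cstar_scheme \<Rightarrow> ('p \<Rightarrow> 'a) \<Rightarrow> ('p set \<Rightarrow> 'a) \<Rightarrow> bool" where
  "boundary_relations P B v e \<longleftrightarrow>
     v ` carrier P \<subseteq> isometries B \<and>
     e ` constructible_ideals P \<subseteq> projections B \<and>
     (\<forall>p\<in>carrier P. \<forall>q\<in>carrier P. v p \<otimes>\<^bsub>B\<^esub> v q = v (p \<otimes>\<^bsub>P\<^esub> q)) \<and>
     (\<forall>p\<in>carrier P. \<forall>I\<in>constructible_ideals P.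
        v p \<otimes>\<^bsub>B\<^esub> e I \<otimes>\<^bsub>B\<^esub> adj B (v p) = e (p <#\<^bsub>P\<^esub> I)) \<and>
     e {} = \<zero>\<^bsub>B\<^esub> \<and> e (carrier P) = \<one>\<^bsub>B\<^esub> \<and>
     (\<forall>I\<in>constructible_ideals P. \<forall>J\<in>constructible_ideals P. e I \<otimes>\<^bsub>B\<^esub> e J = e (I \<inter> J)) \<and>
     (\<forall>Is. distinct Is \<and> foundation_set P (set Is) \<longrightarrow>
        foldr (\<lambda>I b. (\<one>\<^bsub>B\<^esub> \<ominus>\<^bsub>B\<^esub> e I) \<otimes>\<^bsub>B\<^esub> b) Is \<one>\<^bsub>B\<^esub> = \<zero>\<^bsub>B\<^esub>)"

definition boundary_quotient ::
    "('p, 'm) monoid_scheme \<Rightarrow> 'c cstar \<Rightarrow> ('p \<Rightarrow> 'c) \<Rightarrow> ('p set \<Rightarrow> 'c) \<Rightarrow> bool" where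
  "boundary_quotient P Q v e \<longleftrightarrow>
     unital_cstar_algebra Q \<and>
     boundary_relations P Q v e \<and>
     generated_cstar Q (v ` carrier P \<union> e ` constructible_ideals P) = carrier Q \<and>
     (\<forall>B :: 'c cstar. \<forall>w f. unital_cstar_algebra B \<and> boundary_relations P B w f \<longrightarrow>
        (\<exists>!\<Phi>. \<Phi> \<in> extensional (carrier Q) \<and> unital_star_hom Q B \<Phi> \<and>
               (\<forall>p\<in>carrier P. \<Phi> (v p) = w p) \<and>
               (\<forall>I\<in>constructible_ideals P. \<Phi> (e I) = f I)))"


section \<open>Semigroups attached to a ring\<close>

definition ax_plus_b :: "('r, 'm) ring_scheme \<Rightarrow> ('r \<times> 'r) monoid" where
  "ax_plus_b R =
     \<lparr>carrier = carrier R \<times> (carrier R - {\<zero>\<^bsub>R\<^esub>}),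
      monoid.mult = (\<lambda>(r2, p2) (r1, p1). (r2 \<oplus>\<^bsub>R\<^esub> p2 \<otimes>\<^bsub>R\<^esub> r1, p2 \<otimes>\<^bsub>R\<^esub> p1)),
      one = (\<zero>\<^bsub>R\<^esub>, \<one>\<^bsub>R\<^esub>)\<rparr>"

definition opposite :: "('p, 'm) monoid_scheme \<Rightarrow> 'p monoid" where
  "opposite P = \<lparr>carrier = carrier P, monoid.mult = (\<lambda>x y. y \<otimes>\<^bsub>P\<^esub> x), one = \<one>\<^bsub>P\<^esub>\<rparr>"

definition gcd_domain :: "('r, 'm) ring_scheme \<Rightarrow> bool" where
  "gcd_domain R \<longleftrightarrow>
     domain R \<and>
     (\<forall>a\<in>carrier R - {\<zero>\<^bsub>R\<^esub>}. \<forall>b\<in>carrier R - {\<zero>\<^bsub>R\<^esub>}. \<exists>d\<in>carrier R. isgcd R d a b)"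

end

theory Submission
  imports Defs
begin

text \<open>
  Both algebras are generated by unitaries subject to the same relations.

  In the crossed product, covariance at the unit of \<open>A\<close> forces the isometries \<open>s\<^sub>p = iP p\<close> to be
  unitary, because \<open>\<alpha> p\<close> fixes \<open>u \<zero> = \<one>\<close> (lemma \<open>covariant_pair_unitary\<close>). A covariant pair is thus
  a family of unitaries \<open>u\<^sub>r\<close> and \<open>s\<^sub>p\<close> with \<open>s\<^sub>p u\<^sub>r s\<^sub>p\<^sup>* = u\<^bsub>pr\<^esub>\<close>.

  In the boundary quotient, the point is that the opposite ax+b-semigroup is left reversible: the
  ideals generated by \<open>(r, p)\<close> and \<open>(s, q)\<close> share the element
  \<open>(r, p) \<times> (p s, q) = (s, q) \<times> (q r, p)\<close>. Hence any two nonempty constructible ideals meet, every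
  nonempty one is a foundation set by itself, and the last boundary relation collapses its
  projection to \<open>\<one>\<close>; applied to a principal ideal this makes \<open>v\<close> unitary
  (lemmas \<open>boundary_relations_ideal_eq_one\<close> and \<open>boundary_relations_unitary\<close>). Conversely every
  unitary representation of the semigroup, with \<open>\<one>\<close> on all nonempty ideals, satisfies the
  boundary relations (lemma \<open>unitary_hom_boundary_relations\<close>).

  The dictionary \<open>v (r, p) = s\<^sub>p\<^sup>* u\<^sub>r\<close> translates the two kinds of representations into each
  other. The universal properties turn it into homomorphisms in both directions, which are mutually
  inverse since they are so on generators. In
  particular surjectivity comes from the inverse.
\<close>

section \<open>Homomorphisms of unital C*-algebras\<close>

context unital_cstar_algebra
begin

lemma adj_one: "adj A \<one> = \<one>"
  by (metis adj_adj adj_closed adj_mult l_one one_closed)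

lemma adj_zero: "adj A \<zero> = \<zero>"
  by (metis adj_add adj_closed add.r_cancel_one' l_zero zero_closed)

lemma unitaries_closed: "w \<in> unitaries A \<Longrightarrow> w \<in> carrier A"
  by (simp add: unitaries_def)

lemma adj_unitary: "w \<in> unitaries A \<Longrightarrow> adj A w \<in> unitaries A"
  by (simp add: unitaries_def adj_closed adj_adj)

lemma mult_unitary:
  assumes "x \<in> unitaries A" "y \<in> unitaries A"
  shows "x \<otimes> y \<in> unitaries A"
proof -
  have c: "x \<in> carrier A" "y \<in> carrier A" "adj A x \<in> carrier A" "adj A y \<in> carrier A"
    using assms by (auto simp: unitaries_def adj_closed)
  have "adj A y \<otimes> adj A x \<otimes> (x \<otimes> y) = adj A y \<otimes> (adj A x \<otimes> x) \<otimes> y"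
    "x \<otimes> y \<otimes> (adj A y \<otimes> adj A x) = x \<otimes> (y \<otimes> adj A y) \<otimes> adj A x"
    using c by (simp_all add: m_assoc)
  then show ?thesis
    using assms c by (simp add: unitaries_def adj_mult)
qed

lemma idempotent_isometry_eq_one:
  assumes "x \<in> isometries A" "x \<otimes> x = x"
  shows "x = \<one>"
proof -
  have c: "x \<in> carrier A" "adj A x \<in> carrier A" and i: "adj A x \<otimes> x = \<one>"
    using assms by (auto simp: isometries_def adj_closed)
  have "\<one> = adj A x \<otimes> (x \<otimes> x)" using assms(2) i by simp
  also have "\<dots> = x" using c i by (simp add: m_assoc[symmetric])
  finally show ?thesis ..
qed

end

lemma unitaries_subset_isometries: "unitaries A \<subseteq> isometries A"
  by (auto simp: unitaries_def isometries_def)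

lemma unital_star_homD:
  assumes "unital_star_hom A B f"
  shows "x \<in> carrier A \<Longrightarrow> f x \<in> carrier B"
    and "x \<in> carrier A \<Longrightarrow> y \<in> carrier A \<Longrightarrow> f (x \<oplus>\<^bsub>A\<^esub> y) = f x \<oplus>\<^bsub>B\<^esub> f y"
    and "x \<in> carrier A \<Longrightarrow> y \<in> carrier A \<Longrightarrow> f (x \<otimes>\<^bsub>A\<^esub> y) = f x \<otimes>\<^bsub>B\<^esub> f y"
    and "x \<in> carrier A \<Longrightarrow> f (c \<odot>\<^bsub>A\<^esub> x) = c \<odot>\<^bsub>B\<^esub> f x"
    and "x \<in> carrier A \<Longrightarrow> f (adj A x) = adj B (f x)"
    and "f \<one>\<^bsub>A\<^esub> = \<one>\<^bsub>B\<^esub>"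
  using assms by (auto simp: unital_star_hom_def star_hom_def)

lemma unital_star_hom_zero:
  assumes "unital_cstar_algebra A" "unital_cstar_algebra B" "unital_star_hom A B f"
  shows "f \<zero>\<^bsub>A\<^esub> = \<zero>\<^bsub>B\<^esub>"
proof -
  interpret A: unital_cstar_algebra A by fact
  interpret B: unital_cstar_algebra B by fact
  show ?thesis
    by (metis A.zero_closed A.l_zero B.add.r_cancel_one' unital_star_homD(1,2)[OF assms(3)])
qed

lemma unital_star_hom_unitary:
  assumes "unital_cstar_algebra A" "unital_star_hom A B f" "x \<in> unitaries A"
  shows "f x \<in> unitaries B"
proof -
  interpret A: unital_cstar_algebra A by fact
  show ?thesis
    using assms(3) unital_star_homD(1,6)[OF assms(2)]
    by (simp add: unitaries_def A.adj_closed flip: unital_star_homD(3,5)[OF assms(2)])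
qed

lemma unital_star_hom_compose:
  assumes "unital_cstar_algebra A" "unital_star_hom A B f" "unital_star_hom B C g"
  shows "unital_star_hom A C (\<lambda>x. g (f x))"
  unfolding unital_star_hom_def star_hom_def
  by (simp add: Pi_iff unital_star_homD[OF assms(2)] unital_star_homD[OF assms(3)])

lemma unital_star_hom_ident: "unital_star_hom A A (\<lambda>x. x)"
  by (auto simp: unital_star_hom_def star_hom_def)

lemma unital_star_hom_restrict:
  assumes "unital_cstar_algebra A" "unital_star_hom A B f"
  shows "unital_star_hom A B (restrict f (carrier A))"
proof -
  interpret A: unital_cstar_algebra A by fact
  show ?thesis
    using assms(2) unfolding unital_star_hom_def star_hom_def
    by (auto simp: A.smult_closed A.adj_closed)
qed

lemma unital_star_hom_conjugate:
  assumes "unital_cstar_algebra A" "unital_cstar_algebra B"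
    and "unital_star_hom A B f" "w \<in> unitaries B"
  shows "unital_star_hom A B (\<lambda>x. w \<otimes>\<^bsub>B\<^esub> f x \<otimes>\<^bsub>B\<^esub> adj B w)"
proof -
  interpret A: unital_cstar_algebra A by fact
  interpret B: unital_cstar_algebra B by fact
  note f = unital_star_homD[OF assms(3)]
  have w: "w \<in> carrier B" "adj B w \<in> carrier B"
    and ww: "adj B w \<otimes>\<^bsub>B\<^esub> w = \<one>\<^bsub>B\<^esub>" "w \<otimes>\<^bsub>B\<^esub> adj B w = \<one>\<^bsub>B\<^esub>"
    using assms(4) by (auto simp: unitaries_def B.adj_closed)
  have cancel: "adj B w \<otimes>\<^bsub>B\<^esub> (w \<otimes>\<^bsub>B\<^esub> z) = z" if "z \<in> carrier B" for z
    using that w ww by (simp flip: B.m_assoc)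
  show ?thesis
    unfolding unital_star_hom_def star_hom_def
    using w ww
    by (auto simp: f cancel B.m_assoc B.l_distr B.r_distr B.smult_mult_left B.smult_mult_right
        B.adj_mult B.adj_adj)
qed

lemma inverse_homs_imp_isomorphic:
  assumes "unital_star_hom A B f" "unital_star_hom B A g"
    and "\<And>x. x \<in> carrier A \<Longrightarrow> g (f x) = x" "\<And>y. y \<in> carrier B \<Longrightarrow> f (g y) = y"
  shows "unital_star_hom A B f \<and> bij_betw f (carrier A) (carrier B)"
proof -
  have "bij_betw f (carrier A) (carrier B)"
    using assms unital_star_homD(1)[OF assms(1)] unital_star_homD(1)[OF assms(2)]
    by (intro bij_betw_byWitness[where f' = g]) auto
  with assms(1) show ?thesis by blast
qed


section \<open>Rigidity of universal C*-algebras\<close>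

text \<open>
  Two homomorphisms that agree on the generating unitaries both extend the same unitary
  representation. The test is therefore algebraic and takes the place of a density argument.
\<close>

lemma group_cstar_algebra_hom_eq:
  fixes A B :: "'c cstar"
  assumes A: "group_cstar_algebra G A u" and B: "unital_cstar_algebra B"
    and f: "unital_star_hom A B f" and g: "unital_star_hom A B g"
    and fg: "\<And>x. x \<in> carrier G \<Longrightarrow> f (u x) = g (u x)"
    and a: "a \<in> carrier A"
  shows "f a = g a"
proof -
  have alg: "unital_cstar_algebra A" and u: "u \<in> hom G A" "u ` carrier G \<subseteq> unitaries A"
    using A by (auto simp: group_cstar_algebra_def)
  have uc: "u x \<in> carrier A" if "x \<in> carrier G" for x
    using u(1) that by (auto simp: hom_def)
  have "(\<lambda>x. f (u x)) \<in> hom G B"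
    using u(1) unital_star_homD(1,3)[OF f] by (auto simp: hom_def Pi_iff)
  moreover have "(\<lambda>x. f (u x)) ` carrier G \<subseteq> unitaries B"
    using u(2) unital_star_hom_unitary[OF alg f] by auto
  ultimately have ex1: "\<exists>!\<Phi>. \<Phi> \<in> extensional (carrier A) \<and> unital_star_hom A B \<Phi> \<and>
               (\<forall>x\<in>carrier G. \<Phi> (u x) = f (u x))"
    using A B unfolding group_cstar_algebra_def by blast
  have "restrict f (carrier A) = restrict g (carrier A)"
    by (rule Uniq_D[OF conjunct2[OF iffD1[OF ex1_iff_ex_Uniq ex1]]])
      (simp_all add: unital_star_hom_restrict alg f g uc fg)
  then show ?thesis using a by (metis restrict_apply')
qed

lemma crossed_product_hom:
  fixes A U B :: "'c cstar"
  assumes "crossed_product P A \<alpha> U iA iP" "unital_cstar_algebra B" "covariant_pair P A \<alpha> B jA jP"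
  obtains \<Phi> where "unital_star_hom U B \<Phi>" "\<And>a. a \<in> carrier A \<Longrightarrow> \<Phi> (iA a) = jA a"
    "\<And>p. p \<in> carrier P \<Longrightarrow> \<Phi> (iP p) = jP p"
proof -
  have "\<exists>!\<Phi>. \<Phi> \<in> extensional (carrier U) \<and> unital_star_hom U B \<Phi> \<and>
               (\<forall>a\<in>carrier A. \<Phi> (iA a) = jA a) \<and> (\<forall>p\<in>carrier P. \<Phi> (iP p) = jP p)"
    using assms unfolding crossed_product_def by blast
  then show thesis using that by blast
qed

lemma crossed_product_endo_eq_id:
  fixes A U :: "'c cstar"
  assumes U: "crossed_product P A \<alpha> U iA iP" and f: "unital_star_hom U U f"
    and "\<And>a. a \<in> carrier A \<Longrightarrow> f (iA a) = iA a" "\<And>p. p \<in> carrier P \<Longrightarrow> f (iP p) = iP p"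
    and x: "x \<in> carrier U"
  shows "f x = x"
proof -
  have alg: "unital_cstar_algebra U" and cov: "covariant_pair P A \<alpha> U iA iP"
    using U by (auto simp: crossed_product_def)
  have c: "iA a \<in> carrier U" if "a \<in> carrier A" for a
    using cov that by (auto simp: covariant_pair_def unital_star_homD(1))
  have d: "iP p \<in> carrier U" if "p \<in> carrier P" for p
    using cov that by (auto simp: covariant_pair_def hom_def)
  have ex1: "\<exists>!\<Phi>. \<Phi> \<in> extensional (carrier U) \<and> unital_star_hom U U \<Phi> \<and>
               (\<forall>a\<in>carrier A. \<Phi> (iA a) = iA a) \<and> (\<forall>p\<in>carrier P. \<Phi> (iP p) = iP p)"
    using U alg cov unfolding crossed_product_def by blast
  have "restrict f (carrier U) = restrict (\<lambda>x. x) (carrier U)"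
    by (rule Uniq_D[OF conjunct2[OF iffD1[OF ex1_iff_ex_Uniq ex1]]])
      (simp_all add: unital_star_hom_restrict unital_star_hom_ident alg f c d assms(3,4))
  then show ?thesis using x by (metis restrict_apply')
qed

lemma boundary_quotient_hom:
  fixes Q B :: "'c cstar"
  assumes "boundary_quotient P Q v e" "unital_cstar_algebra B" "boundary_relations P B w f"
  obtains \<Psi> where "unital_star_hom Q B \<Psi>" "\<And>p. p \<in> carrier P \<Longrightarrow> \<Psi> (v p) = w p"
    "\<And>I. I \<in> constructible_ideals P \<Longrightarrow> \<Psi> (e I) = f I"
proof -
  have "\<exists>!\<Psi>. \<Psi> \<in> extensional (carrier Q) \<and> unital_star_hom Q B \<Psi> \<and>
               (\<forall>p\<in>carrier P. \<Psi> (v p) = w p) \<and>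
               (\<forall>I\<in>constructible_ideals P. \<Psi> (e I) = f I)"
    using assms unfolding boundary_quotient_def by blast
  then show thesis using that by blast
qed

lemma boundary_quotient_endo_eq_id:
  fixes Q :: "'c cstar"
  assumes Q: "boundary_quotient P Q v e" and f: "unital_star_hom Q Q f"
    and "\<And>p. p \<in> carrier P \<Longrightarrow> f (v p) = v p"
    and "\<And>I. I \<in> constructible_ideals P \<Longrightarrow> f (e I) = e I"
    and x: "x \<in> carrier Q"
  shows "f x = x"
proof -
  have alg: "unital_cstar_algebra Q" and rel: "boundary_relations P Q v e"
    using Q by (auto simp: boundary_quotient_def)
  have c: "v p \<in> carrier Q" if "p \<in> carrier P" for p
    using rel that by (auto simp: boundary_relations_def isometries_def)
  have d: "e I \<in> carrier Q" if "I \<in> constructible_ideals P" for I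
    using rel that by (auto simp: boundary_relations_def projections_def)
  have ex1: "\<exists>!\<Phi>. \<Phi> \<in> extensional (carrier Q) \<and> unital_star_hom Q Q \<Phi> \<and>
               (\<forall>p\<in>carrier P. \<Phi> (v p) = v p) \<and>
               (\<forall>I\<in>constructible_ideals P. \<Phi> (e I) = e I)"
    using Q alg rel unfolding boundary_quotient_def by blast
  have "restrict f (carrier Q) = restrict (\<lambda>x. x) (carrier Q)"
    by (rule Uniq_D[OF conjunct2[OF iffD1[OF ex1_iff_ex_Uniq ex1]]])
      (simp_all add: unital_star_hom_restrict unital_star_hom_ident alg f c d assms(3,4))
  then show ?thesis using x by (metis restrict_apply')
qed


section \<open>Boundary relations of left reversible monoids\<close>

text \<open>Left reversibility is Ore's condition that any two principal right ideals meet.\<close>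

locale left_reversible_monoid = monoid P for P :: "('p, 'm) monoid_scheme" (structure) +
  assumes common_right_multiple:
    "x \<in> carrier P \<Longrightarrow> y \<in> carrier P \<Longrightarrow> \<exists>a\<in>carrier P. \<exists>b\<in>carrier P. x \<otimes> a = y \<otimes> b"

context monoid
begin

lemma constructible_right_ideal:
  assumes "I \<in> constructible_ideals G"
  shows "I \<subseteq> carrier G \<and> (\<forall>x\<in>I. \<forall>a\<in>carrier G. x \<otimes> a \<in> I)"
proof -
  have "set w \<subseteq> carrier G \<times> carrier G \<Longrightarrow>
    (let I = foldr (\<lambda>(p, q) I. left_preimage G p (q <#\<^bsub>G\<^esub> I)) w (carrier G) in
     I \<subseteq> carrier G \<and> (\<forall>x\<in>I. \<forall>a\<in>carrier G. x \<otimes> a \<in> I))" for w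
  proof (induction w)
    case Nil
    then show ?case by simp
  next
    case (Cons pq w)
    obtain p q where pq: "pq = (p, q)" "p \<in> carrier G" "q \<in> carrier G"
      using Cons.prems by (cases pq) auto
    define I where "I = foldr (\<lambda>(p, q) I. left_preimage G p (q <#\<^bsub>G\<^esub> I)) w (carrier G)"
    have IH: "I \<subseteq> carrier G" "\<And>x a. x \<in> I \<Longrightarrow> a \<in> carrier G \<Longrightarrow> x \<otimes> a \<in> I"
      using Cons unfolding I_def[symmetric] by auto
    have "x \<otimes> a \<in> left_preimage G p (q <#\<^bsub>G\<^esub> I)"
      if x: "x \<in> left_preimage G p (q <#\<^bsub>G\<^esub> I)" and a: "a \<in> carrier G" for x a
    proof -
      obtain y where y: "x \<in> carrier G" "y \<in> I" "p \<otimes> x = q \<otimes> y"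
        using x by (auto simp: left_preimage_def l_coset_def)
      then have "p \<otimes> (x \<otimes> a) = q \<otimes> (y \<otimes> a)"
        using pq a IH(1) by (auto simp flip: m_assoc)
      then show ?thesis
        using y a IH(2) by (auto simp: left_preimage_def l_coset_def)
    qed
    then show ?case
      unfolding pq(1) foldr.simps o_def split I_def[symmetric] Let_def
      by (auto simp: left_preimage_def)
  qed
  then show ?thesis
    using assms by (auto simp: constructible_ideals_def Let_def)
qed

lemma principal_constructible:
  assumes "p \<in> carrier G"
  shows "p <#\<^bsub>G\<^esub> carrier G \<in> constructible_ideals G"
proof -
  have "foldr (\<lambda>(p, q) I. left_preimage G p (q <#\<^bsub>G\<^esub> I)) [(\<one>, p)] (carrier G) = p <#\<^bsub>G\<^esub> carrier G"
    using assms by (auto simp: left_preimage_def l_coset_def)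
  then show ?thesis
    using assms unfolding constructible_ideals_def by (intro UnI1 CollectI exI[of _ "[(\<one>, p)]"]) auto
qed

lemma carrier_constructible: "carrier G \<in> constructible_ideals G"
proof -
  have "\<one> <#\<^bsub>G\<^esub> carrier G = carrier G" by (auto simp: l_coset_def)
  then show ?thesis using principal_constructible[of \<one>] by simp
qed

end

context left_reversible_monoid
begin

lemma constructible_ideals_meet:
  assumes "I \<in> constructible_ideals P" "J \<in> constructible_ideals P" "I \<noteq> {}" "J \<noteq> {}"
  shows "I \<inter> J \<noteq> {}"
proof -
  obtain x y where "x \<in> I" "y \<in> J" using assms by blast
  moreover from this obtain a b where "a \<in> carrier P" "b \<in> carrier P" "x \<otimes> a = y \<otimes> b"
    using common_right_multiple constructible_right_ideal assms(1,2) by (meson subsetD)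
  ultimately show ?thesis
    using constructible_right_ideal assms(1,2) by (metis IntI empty_iff)
qed

lemma singleton_foundation_set:
  assumes "I \<in> constructible_ideals P" "I \<noteq> {}"
  shows "foundation_set P {I}"
  using assms constructible_ideals_meet by (auto simp: foundation_set_def)

lemma boundary_relations_ideal_eq_one:
  assumes B: "unital_cstar_algebra B" and rel: "boundary_relations P B v e"
    and I: "I \<in> constructible_ideals P" "I \<noteq> {}"
  shows "e I = \<one>\<^bsub>B\<^esub>"
proof -
  interpret B: unital_cstar_algebra B by fact
  have eI: "e I \<in> carrier B"
    using rel I by (auto simp: boundary_relations_def projections_def)
  have "distinct [I] \<and> foundation_set P (set [I])"
    using singleton_foundation_set[OF I] by simp
  then have "foldr (\<lambda>I b. (\<one>\<^bsub>B\<^esub> \<ominus>\<^bsub>B\<^esub> e I) \<otimes>\<^bsub>B\<^esub> b) [I] \<one>\<^bsub>B\<^esub> = \<zero>\<^bsub>B\<^esub>"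
    using rel unfolding boundary_relations_def by blast
  then show ?thesis using eI by simp
qed

text \<open>The range projection of \<open>v p\<close> is the projection of the ideal \<open>pP\<close>, which is nonempty.\<close>

lemma boundary_relations_unitary:
  assumes B: "unital_cstar_algebra B" and rel: "boundary_relations P B v e"
    and p: "p \<in> carrier P"
  shows "v p \<in> unitaries B"
proof -
  interpret B: unital_cstar_algebra B by fact
  have vp: "v p \<in> carrier B" "adj B (v p) \<otimes>\<^bsub>B\<^esub> v p = \<one>\<^bsub>B\<^esub>"
    using rel p by (auto simp: boundary_relations_def isometries_def)
  have "p \<otimes> \<one> \<in> p <#\<^bsub>P\<^esub> carrier P" unfolding l_coset_def using p by blast
  then have "e (p <#\<^bsub>P\<^esub> carrier P) = \<one>\<^bsub>B\<^esub>"
    using boundary_relations_ideal_eq_one[OF B rel principal_constructible[OF p]] by blast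
  moreover have "v p \<otimes>\<^bsub>B\<^esub> e (carrier P) \<otimes>\<^bsub>B\<^esub> adj B (v p) = e (p <#\<^bsub>P\<^esub> carrier P)"
    using rel p carrier_constructible unfolding boundary_relations_def by blast
  moreover have "e (carrier P) = \<one>\<^bsub>B\<^esub>"
    using rel by (auto simp: boundary_relations_def)
  ultimately show ?thesis
    using vp by (simp add: unitaries_def)
qed

lemma boundary_relations_one:
  assumes B: "unital_cstar_algebra B" and rel: "boundary_relations P B v e"
  shows "v \<one> = \<one>\<^bsub>B\<^esub>"
proof -
  interpret B: unital_cstar_algebra B by fact
  have "v \<one> \<in> isometries B" "v \<one> \<otimes>\<^bsub>B\<^esub> v \<one> = v (\<one> \<otimes> \<one>)"
    using rel one_closed unfolding boundary_relations_def by blast+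
  then show ?thesis by (intro B.idempotent_isometry_eq_one) auto
qed

text \<open>
  The indicator of nonemptiness is multiplicative because nonempty ideals meet. A foundation set
  contains a nonempty ideal, as it must meet the whole monoid, so that the product in the last
  relation has a vanishing factor.
\<close>

lemma unitary_hom_boundary_relations:
  assumes B: "unital_cstar_algebra B"
    and w: "w \<in> hom P B" "w ` carrier P \<subseteq> unitaries B"
  shows "boundary_relations P B w (\<lambda>I. if I = {} then \<zero>\<^bsub>B\<^esub> else \<one>\<^bsub>B\<^esub>)"
proof -
  interpret B: unital_cstar_algebra B by fact
  define f where "f I = (if I = {} then \<zero>\<^bsub>B\<^esub> else \<one>\<^bsub>B\<^esub>)" for I :: "'p set"
  have diff: "\<one>\<^bsub>B\<^esub> \<ominus>\<^bsub>B\<^esub> f I = (if I = {} then \<one>\<^bsub>B\<^esub> else \<zero>\<^bsub>B\<^esub>)" for I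
    by (simp add: f_def B.minus_eq B.r_neg)
  have prod: "foldr (\<lambda>I b. (\<one>\<^bsub>B\<^esub> \<ominus>\<^bsub>B\<^esub> f I) \<otimes>\<^bsub>B\<^esub> b) Is \<one>\<^bsub>B\<^esub> \<in> carrier B \<and>
    ((\<exists>I\<in>set Is. I \<noteq> {}) \<longrightarrow> foldr (\<lambda>I b. (\<one>\<^bsub>B\<^esub> \<ominus>\<^bsub>B\<^esub> f I) \<otimes>\<^bsub>B\<^esub> b) Is \<one>\<^bsub>B\<^esub> = \<zero>\<^bsub>B\<^esub>)" for Is
    by (induction Is) (auto simp: diff)
  have carrier_nonempty: "carrier P \<noteq> {}" using one_closed by blast
  have nonempty: "\<exists>I\<in>set Is. I \<noteq> {}" if found: "foundation_set P (set Is)" for Is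
  proof -
    have "\<exists>J\<in>set Is. carrier P \<inter> J \<noteq> {}"
      using found carrier_nonempty carrier_constructible by (simp add: foundation_set_def)
    then show ?thesis by blast
  qed
  have "boundary_relations P B w f"
    unfolding boundary_relations_def
  proof (intro conjI ballI allI impI)
    show "w ` carrier P \<subseteq> isometries B"
      using w(2) unitaries_subset_isometries[of B] by (rule subset_trans)
    show "f ` constructible_ideals P \<subseteq> projections B"
      by (auto simp: f_def projections_def B.adj_one B.adj_zero)
  next
    fix p q assume "p \<in> carrier P" "q \<in> carrier P"
    then show "w p \<otimes>\<^bsub>B\<^esub> w q = w (p \<otimes> q)" using w(1) by (simp add: hom_def)
  next
    fix p I assume p: "p \<in> carrier P"
    have "w p \<in> unitaries B" using w(2) p by blast
    moreover have "f (p <#\<^bsub>P\<^esub> I) = f I" by (simp add: f_def l_coset_def)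
    ultimately show "w p \<otimes>\<^bsub>B\<^esub> f I \<otimes>\<^bsub>B\<^esub> adj B (w p) = f (p <#\<^bsub>P\<^esub> I)"
      by (simp add: f_def unitaries_def B.adj_closed)
  next
    show "f {} = \<zero>\<^bsub>B\<^esub>" by (simp add: f_def)
    show "f (carrier P) = \<one>\<^bsub>B\<^esub>" using carrier_nonempty by (simp add: f_def)
  next
    fix I J assume "I \<in> constructible_ideals P" "J \<in> constructible_ideals P"
    then show "f I \<otimes>\<^bsub>B\<^esub> f J = f (I \<inter> J)"
      using constructible_ideals_meet[of I J] by (simp add: f_def)
  next
    fix Is assume "distinct Is \<and> foundation_set P (set Is)"
    then show "foldr (\<lambda>I b. (\<one>\<^bsub>B\<^esub> \<ominus>\<^bsub>B\<^esub> f I) \<otimes>\<^bsub>B\<^esub> b) Is \<one>\<^bsub>B\<^esub> = \<zero>\<^bsub>B\<^esub>"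
      using prod nonempty by blast
  qed
  moreover have "f = (\<lambda>I. if I = {} then \<zero>\<^bsub>B\<^esub> else \<one>\<^bsub>B\<^esub>)"
    by (rule ext) (simp add: f_def)
  ultimately show ?thesis by simp
qed

end


section \<open>The opposite ax+b-semigroup of a domain\<close>

lemma opposite_ax_plus_b_simps:
  "carrier (opposite (ax_plus_b R)) = carrier R \<times> (carrier R - {\<zero>\<^bsub>R\<^esub>})"
  "(r1, p1) \<otimes>\<^bsub>opposite (ax_plus_b R)\<^esub> (r2, p2) = (r2 \<oplus>\<^bsub>R\<^esub> p2 \<otimes>\<^bsub>R\<^esub> r1, p2 \<otimes>\<^bsub>R\<^esub> p1)"
  "\<one>\<^bsub>opposite (ax_plus_b R)\<^esub> = (\<zero>\<^bsub>R\<^esub>, \<one>\<^bsub>R\<^esub>)"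
  by (simp_all add: opposite_def ax_plus_b_def)

lemma (in domain) left_reversible_opposite_ax_plus_b:
  "left_reversible_monoid (opposite (ax_plus_b R))"
proof (unfold_locales, goal_cases)
  case (1 x y)
  then show ?case by (auto simp: opposite_ax_plus_b_simps integral_iff)
next
  case (2 x y z)
  then show ?case
    by (auto simp: opposite_ax_plus_b_simps m_assoc r_distr a_assoc)
next
  case 3
  then show ?case by (simp add: opposite_ax_plus_b_simps)
next
  case (4 x)
  then show ?case by (auto simp: opposite_ax_plus_b_simps)
next
  case (5 x)
  then show ?case by (auto simp: opposite_ax_plus_b_simps)
next
  case (6 x y)
  then obtain r p s q where xy: "x = (r, p)" "y = (s, q)" "r \<in> carrier R" "s \<in> carrier R"
    "p \<in> carrier R - {\<zero>}" "q \<in> carrier R - {\<zero>}"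
    by (auto simp: opposite_ax_plus_b_simps)
  then have "x \<otimes>\<^bsub>opposite (ax_plus_b R)\<^esub> (p \<otimes> s, q) = y \<otimes>\<^bsub>opposite (ax_plus_b R)\<^esub> (q \<otimes> r, p)"
    by (simp add: opposite_ax_plus_b_simps m_comm a_comm)
  then show ?case
    using xy by (force simp: opposite_ax_plus_b_simps)
qed


section \<open>Covariant pairs and boundary relations\<close>

lemma covariant_pair_unitary:
  assumes B: "unital_cstar_algebra B" and A: "unital_cstar_algebra A"
    and cov: "covariant_pair P A \<alpha> B jA jP"
    and p: "p \<in> carrier P" "\<alpha> p \<one>\<^bsub>A\<^esub> = \<one>\<^bsub>A\<^esub>"
  shows "jP p \<in> unitaries B"
proof -
  interpret A: unital_cstar_algebra A by fact
  interpret B: unital_cstar_algebra B by fact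
  have j: "unital_star_hom A B jA" using cov by (simp add: covariant_pair_def)
  have s: "jP p \<in> carrier B" "adj B (jP p) \<otimes>\<^bsub>B\<^esub> jP p = \<one>\<^bsub>B\<^esub>"
    using cov p by (auto simp: covariant_pair_def isometries_def)
  have "jP p \<otimes>\<^bsub>B\<^esub> jA \<one>\<^bsub>A\<^esub> \<otimes>\<^bsub>B\<^esub> adj B (jP p) = jA \<one>\<^bsub>A\<^esub>"
    using cov p A.one_closed unfolding covariant_pair_def by metis
  then show ?thesis using s by (simp add: unital_star_homD(6)[OF j] unitaries_def)
qed

locale domain_cstar_action = domain R for R :: "('r, 'm) ring_scheme" (structure) +
  fixes A :: "'c cstar" and u :: "'r \<Rightarrow> 'c" and \<alpha> :: "'r \<Rightarrow> 'c \<Rightarrow> 'c"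
  assumes group_algebra: "group_cstar_algebra (add_monoid R) A u"
    and action: "endo_action (mult_of R) A \<alpha>"
    and action_generator:
      "p \<in> carrier (mult_of R) \<Longrightarrow> r \<in> carrier R \<Longrightarrow> \<alpha> p (u r) = u (p \<otimes> r)"
begin

sublocale A: unital_cstar_algebra A
  using group_algebra by (simp add: group_cstar_algebra_def)

lemma u_unitary: "r \<in> carrier R \<Longrightarrow> u r \<in> unitaries A"
  and u_add: "r \<in> carrier R \<Longrightarrow> s \<in> carrier R \<Longrightarrow> u (r \<oplus> s) = u r \<otimes>\<^bsub>A\<^esub> u s"
  using group_algebra by (auto simp: group_cstar_algebra_def hom_def)

lemma u_closed: "r \<in> carrier R \<Longrightarrow> u r \<in> carrier A"
  by (simp add: u_unitary A.unitaries_closed)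

lemma u_zero: "u \<zero> = \<one>\<^bsub>A\<^esub>"
  using u_unitary[of \<zero>] u_add[of \<zero> \<zero>] unitaries_subset_isometries[of A]
  by (intro A.idempotent_isometry_eq_one) auto

lemma action_unital:
  assumes "p \<in> carrier R - {\<zero>}"
  shows "\<alpha> p \<one>\<^bsub>A\<^esub> = \<one>\<^bsub>A\<^esub>" "unital_star_hom A A (\<alpha> p)"
proof -
  show "\<alpha> p \<one>\<^bsub>A\<^esub> = \<one>\<^bsub>A\<^esub>"
    using action_generator[of p \<zero>] assms by (simp add: u_zero)
  then show "unital_star_hom A A (\<alpha> p)"
    using action assms by (simp add: unital_star_hom_def endo_action_def)
qed

text \<open>
  In the opposite semigroup \<open>(r, \<one>) \<times> (\<zero>, p) = (p r, p) = (\<zero>, p) \<times> (p r, \<one>)\<close>. Since \<open>v (\<zero>, p)\<close>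
  is unitary, its adjoint therefore conjugates \<open>v (r, \<one>)\<close> to \<open>v (p r, \<one>)\<close>, which is covariance on
  the generators of \<open>A\<close>. The adjoint reverses products, which is harmless as \<open>R\<close> is commutative.
\<close>

lemma boundary_relations_covariant_pair:
  fixes B :: "'c cstar"
  assumes B: "unital_cstar_algebra B"
    and rel: "boundary_relations (opposite (ax_plus_b R)) B v e"
  obtains j where "covariant_pair (mult_of R) A \<alpha> B j (\<lambda>p. adj B (v (\<zero>, p)))"
    and "\<And>r. r \<in> carrier R \<Longrightarrow> j (u r) = v (r, \<one>)"
proof -
  interpret B: unital_cstar_algebra B by fact
  interpret P: left_reversible_monoid "opposite (ax_plus_b R)"
    by (rule left_reversible_opposite_ax_plus_b)
  have v_unitary: "v (r, p) \<in> unitaries B" if "r \<in> carrier R" "p \<in> carrier R - {\<zero>}" for r p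
    using that P.boundary_relations_unitary[OF B rel] by (auto simp: opposite_ax_plus_b_simps)
  have v_mult: "v (r, p) \<otimes>\<^bsub>B\<^esub> v (s, q) = v (s \<oplus> q \<otimes> r, q \<otimes> p)"
    if "r \<in> carrier R" "p \<in> carrier R - {\<zero>}" "s \<in> carrier R" "q \<in> carrier R - {\<zero>}" for r p s q
    using that rel
    by (simp add: boundary_relations_def opposite_ax_plus_b_simps(1) flip: opposite_ax_plus_b_simps(2))
  have v_one: "v (\<zero>, \<one>) = \<one>\<^bsub>B\<^esub>"
    using P.boundary_relations_one[OF B rel] by (simp add: opposite_ax_plus_b_simps)
  have "(\<lambda>r. v (r, \<one>)) \<in> hom (add_monoid R) B"
    using v_unitary v_mult by (auto simp: hom_def B.unitaries_closed a_comm)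
  moreover have "(\<lambda>r. v (r, \<one>)) ` carrier (add_monoid R) \<subseteq> unitaries B"
    using v_unitary by auto
  ultimately obtain j where j: "unital_star_hom A B j" "\<And>r. r \<in> carrier R \<Longrightarrow> j (u r) = v (r, \<one>)"
    using group_algebra B unfolding group_cstar_algebra_def
    by (metis (no_types, lifting) monoid.select_convs(1) partial_object.select_convs(1))
  define s where "s p = adj B (v (\<zero>, p))" for p
  have s: "s p \<in> unitaries B" "adj B (s p) = v (\<zero>, p)" if "p \<in> carrier R - {\<zero>}" for p
    using that v_unitary by (auto simp: s_def B.adj_unitary B.adj_adj B.unitaries_closed)
  have "s \<in> hom (mult_of R) B"
  proof (rule homI)
    fix p q assume pq: "p \<in> carrier (mult_of R)" "q \<in> carrier (mult_of R)"
    then have "v (\<zero>, p \<otimes> q) = v (\<zero>, q) \<otimes>\<^bsub>B\<^esub> v (\<zero>, p)"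
      using v_mult[of \<zero> q \<zero> p] by simp
    then show "s (p \<otimes>\<^bsub>mult_of R\<^esub> q) = s p \<otimes>\<^bsub>B\<^esub> s q"
      using pq v_unitary by (simp add: s_def B.adj_mult B.unitaries_closed)
  qed (use s in \<open>auto simp: B.unitaries_closed\<close>)
  moreover have "s \<one> = \<one>\<^bsub>B\<^esub>" by (simp add: s_def v_one B.adj_one)
  moreover have "s ` carrier (mult_of R) \<subseteq> isometries B"
    using s(1) unitaries_subset_isometries[of B] unfolding carrier_mult_of by blast
  moreover have "s p \<otimes>\<^bsub>B\<^esub> j a \<otimes>\<^bsub>B\<^esub> adj B (s p) = j (\<alpha> p a)"
    if p: "p \<in> carrier R - {\<zero>}" and a: "a \<in> carrier A" for p a
  proof (rule group_cstar_algebra_hom_eq[OF group_algebra B _ _ _ a])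
    show "unital_star_hom A B (\<lambda>a. s p \<otimes>\<^bsub>B\<^esub> j a \<otimes>\<^bsub>B\<^esub> adj B (s p))"
      using p j s by (intro unital_star_hom_conjugate A.unital_cstar_algebra_axioms B)
    show "unital_star_hom A B (\<lambda>a. j (\<alpha> p a))"
      using action_unital(2)[OF p] j(1) by (rule unital_star_hom_compose[OF A.unital_cstar_algebra_axioms])
  next
    fix r assume "r \<in> carrier (add_monoid R)"
    then have r: "r \<in> carrier R" by simp
    have c: "v (\<zero>, p) \<in> carrier B" "v (p \<otimes> r, \<one>) \<in> carrier B" "s p \<in> carrier B"
      and sv: "s p \<otimes>\<^bsub>B\<^esub> v (\<zero>, p) = \<one>\<^bsub>B\<^esub>"
      using v_unitary[of \<zero> p] v_unitary[of "p \<otimes> r" \<one>] p r s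
      by (auto simp: unitaries_def s_def)
    have "v (r, \<one>) \<otimes>\<^bsub>B\<^esub> v (\<zero>, p) = v (\<zero>, p) \<otimes>\<^bsub>B\<^esub> v (p \<otimes> r, \<one>)"
      using p r by (simp add: v_mult)
    then have "s p \<otimes>\<^bsub>B\<^esub> v (r, \<one>) \<otimes>\<^bsub>B\<^esub> v (\<zero>, p) = s p \<otimes>\<^bsub>B\<^esub> v (\<zero>, p) \<otimes>\<^bsub>B\<^esub> v (p \<otimes> r, \<one>)"
      using c p r v_unitary[of r \<one>] by (simp add: B.m_assoc B.unitaries_closed)
    then show "s p \<otimes>\<^bsub>B\<^esub> j (u r) \<otimes>\<^bsub>B\<^esub> adj B (s p) = j (\<alpha> p (u r))"
      using p r c sv by (simp add: j(2) s action_generator)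
  qed
  ultimately have "covariant_pair (mult_of R) A \<alpha> B j s"
    using j(1) by (simp add: covariant_pair_def)
  then show thesis using j(2) that by (simp add: s_def[abs_def])
qed

text \<open>
  The inverse dictionary. Moving \<open>s\<^sub>p\<^sup>*\<close> past \<open>u\<^sub>t\<close> replaces \<open>t\<close> by \<open>p t\<close>, which is the twist in the
  multiplication of the ax+b-semigroup.
\<close>

lemma covariant_pair_boundary_relations:
  fixes B :: "'c cstar"
  assumes B: "unital_cstar_algebra B" and cov: "covariant_pair (mult_of R) A \<alpha> B j s"
  shows "boundary_relations (opposite (ax_plus_b R)) B
    (\<lambda>(r, p). adj B (s p) \<otimes>\<^bsub>B\<^esub> j (u r)) (\<lambda>I. if I = {} then \<zero>\<^bsub>B\<^esub> else \<one>\<^bsub>B\<^esub>)"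
proof -
  interpret B: unital_cstar_algebra B by fact
  interpret P: left_reversible_monoid "opposite (ax_plus_b R)"
    by (rule left_reversible_opposite_ax_plus_b)
  have j: "unital_star_hom A B j" and s_mult:
    "\<And>p q. p \<in> carrier R - {\<zero>} \<Longrightarrow> q \<in> carrier R - {\<zero>} \<Longrightarrow> s (p \<otimes> q) = s p \<otimes>\<^bsub>B\<^esub> s q"
    and conj: "\<And>p a. p \<in> carrier R - {\<zero>} \<Longrightarrow> a \<in> carrier A \<Longrightarrow>
      s p \<otimes>\<^bsub>B\<^esub> j a \<otimes>\<^bsub>B\<^esub> adj B (s p) = j (\<alpha> p a)"
    using cov by (auto simp: covariant_pair_def hom_def)
  have s: "s p \<in> unitaries B" if "p \<in> carrier R - {\<zero>}" for p
    using that by (intro covariant_pair_unitary[OF B A.unital_cstar_algebra_axioms cov] action_unital) auto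
  have ju: "j (u r) \<in> unitaries B" if "r \<in> carrier R" for r
    using that by (intro unital_star_hom_unitary[OF A.unital_cstar_algebra_axioms j] u_unitary)
  define w where "w = (\<lambda>(r, p). adj B (s p) \<otimes>\<^bsub>B\<^esub> j (u r))"
  have w: "w (r, p) \<in> unitaries B" if "r \<in> carrier R" "p \<in> carrier R - {\<zero>}" for r p
    using that s ju by (simp add: w_def B.mult_unitary B.adj_unitary)
  have w_mult: "w (r \<oplus> p \<otimes> t, p \<otimes> q) = w (t, q) \<otimes>\<^bsub>B\<^esub> w (r, p)"
    if r: "r \<in> carrier R" "t \<in> carrier R" and p: "p \<in> carrier R - {\<zero>}" "q \<in> carrier R - {\<zero>}" for r t p q
  proof -
    let ?x = "j (u t)" and ?y = "j (u (p \<otimes> t))"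
    have c: "s p \<in> carrier B" "s q \<in> carrier B" "adj B (s p) \<in> carrier B" "adj B (s q) \<in> carrier B"
      "?x \<in> carrier B" "?y \<in> carrier B" "j (u r) \<in> carrier B"
      and inv: "adj B (s p) \<otimes>\<^bsub>B\<^esub> s p = \<one>\<^bsub>B\<^esub>"
      using s[OF p(1)] s[OF p(2)] ju r p by (auto simp: unitaries_def B.adj_closed)
    have y: "?y = s p \<otimes>\<^bsub>B\<^esub> (?x \<otimes>\<^bsub>B\<^esub> adj B (s p))"
      using conj[of p "u t"] p r c by (simp add: u_closed action_generator B.m_assoc)
    have comm: "adj B (s p) \<otimes>\<^bsub>B\<^esub> ?y = ?x \<otimes>\<^bsub>B\<^esub> adj B (s p)"
      unfolding y using c inv by (simp flip: B.m_assoc)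
    have "u (r \<oplus> p \<otimes> t) = u (p \<otimes> t) \<otimes>\<^bsub>A\<^esub> u r"
      using r p a_comm[of r "p \<otimes> t"] u_add[of "p \<otimes> t" r] by simp
    then have "w (r \<oplus> p \<otimes> t, p \<otimes> q)
        = adj B (s q) \<otimes>\<^bsub>B\<^esub> adj B (s p) \<otimes>\<^bsub>B\<^esub> (?y \<otimes>\<^bsub>B\<^esub> j (u r))"
      using r p c by (simp add: w_def s_mult B.adj_mult u_closed unital_star_homD(3)[OF j])
    also have "\<dots> = adj B (s q) \<otimes>\<^bsub>B\<^esub> (adj B (s p) \<otimes>\<^bsub>B\<^esub> ?y) \<otimes>\<^bsub>B\<^esub> j (u r)"
      using c by (simp add: B.m_assoc)
    also have "\<dots> = w (t, q) \<otimes>\<^bsub>B\<^esub> w (r, p)"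
      unfolding comm using c by (simp add: w_def B.m_assoc)
    finally show ?thesis .
  qed
  have "w \<in> hom (opposite (ax_plus_b R)) B"
  proof (rule homI)
    fix x assume "x \<in> carrier (opposite (ax_plus_b R))"
    then show "w x \<in> carrier B"
      using B.unitaries_closed[OF w] by (cases x) (simp add: opposite_ax_plus_b_simps)
  next
    fix x y assume "x \<in> carrier (opposite (ax_plus_b R))" "y \<in> carrier (opposite (ax_plus_b R))"
    then show "w (x \<otimes>\<^bsub>opposite (ax_plus_b R)\<^esub> y) = w x \<otimes>\<^bsub>B\<^esub> w y"
      by (cases x; cases y) (simp add: opposite_ax_plus_b_simps w_mult)
  qed
  moreover have "w ` carrier (opposite (ax_plus_b R)) \<subseteq> unitaries B"
    using w by (auto simp: opposite_ax_plus_b_simps)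
  ultimately show ?thesis
    unfolding w_def by (rule P.unitary_hom_boundary_relations[OF B])
qed

theorem crossed_product_iso_boundary_quotient:
  fixes U Q :: "'c cstar"
  assumes crossed: "crossed_product (mult_of R) A \<alpha> U iA iP"
    and quotient: "boundary_quotient (opposite (ax_plus_b R)) Q v e"
  obtains \<Phi> where "unital_star_hom U Q \<Phi>" "bij_betw \<Phi> (carrier U) (carrier Q)"
proof -
  interpret P: left_reversible_monoid "opposite (ax_plus_b R)"
    by (rule left_reversible_opposite_ax_plus_b)
  have U: "unital_cstar_algebra U" and cov: "covariant_pair (mult_of R) A \<alpha> U iA iP"
    using crossed by (auto simp: crossed_product_def)
  have Q: "unital_cstar_algebra Q" and rel: "boundary_relations (opposite (ax_plus_b R)) Q v e"
    using quotient by (auto simp: boundary_quotient_def)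
  interpret U: unital_cstar_algebra U by fact
  interpret Q: unital_cstar_algebra Q by fact
  let ?w = "\<lambda>(r, p). adj U (iP p) \<otimes>\<^bsub>U\<^esub> iA (u r)"
  let ?f = "\<lambda>I :: ('r \<times> 'r) set. if I = {} then \<zero>\<^bsub>U\<^esub> else \<one>\<^bsub>U\<^esub>"
  obtain j where j: "covariant_pair (mult_of R) A \<alpha> Q j (\<lambda>p. adj Q (v (\<zero>, p)))"
    and ju: "\<And>r. r \<in> carrier R \<Longrightarrow> j (u r) = v (r, \<one>)"
    using boundary_relations_covariant_pair[OF Q rel] by blast
  obtain \<Phi> where \<Phi>: "unital_star_hom U Q \<Phi>" "\<And>a. a \<in> carrier A \<Longrightarrow> \<Phi> (iA a) = j a"
    "\<And>p. p \<in> carrier R - {\<zero>} \<Longrightarrow> \<Phi> (iP p) = adj Q (v (\<zero>, p))"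
    using crossed_product_hom[OF crossed Q j] unfolding carrier_mult_of by blast
  have "boundary_relations (opposite (ax_plus_b R)) U ?w ?f"
    by (rule covariant_pair_boundary_relations[OF U cov])
  then obtain \<Psi> where \<Psi>: "unital_star_hom Q U \<Psi>"
    "\<And>x. x \<in> carrier (opposite (ax_plus_b R)) \<Longrightarrow> \<Psi> (v x) = ?w x"
    using boundary_quotient_hom[OF quotient U] by blast
  have iA: "unital_star_hom A U iA" and iP_one: "iP \<one> = \<one>\<^bsub>U\<^esub>"
    using cov by (auto simp: covariant_pair_def)
  have iP_c: "iP p \<in> carrier U" if "p \<in> carrier R - {\<zero>}" for p
    using cov that by (auto simp: covariant_pair_def hom_def)
  have iAu_c: "iA (u r) \<in> carrier U" if "r \<in> carrier R" for r
    using that u_closed unital_star_homD(1)[OF iA] by blast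
  have v_c: "v x \<in> carrier Q" if "x \<in> carrier (opposite (ax_plus_b R))" for x
    using rel that by (auto simp: boundary_relations_def isometries_def)
  have \<Psi>v: "\<Psi> (v (r, p)) = adj U (iP p) \<otimes>\<^bsub>U\<^esub> iA (u r)"
    if "r \<in> carrier R" "p \<in> carrier R - {\<zero>}" for r p
    using \<Psi>(2)[of "(r, p)"] that by (simp add: opposite_ax_plus_b_simps)

  \<comment> \<open>On \<open>iA a\<close> for general \<open>a\<close>, the universal property of \<open>A\<close> reduces the claim to \<open>a = u r\<close>.\<close>
  have "\<Psi> (\<Phi> x) = x" if "x \<in> carrier U" for x
  proof (rule crossed_product_endo_eq_id[OF crossed _ _ _ that])
    show "unital_star_hom U U (\<lambda>x. \<Psi> (\<Phi> x))"
      by (rule unital_star_hom_compose[OF U \<Phi>(1) \<Psi>(1)])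
  next
    have "unital_star_hom A Q j" using j by (simp add: covariant_pair_def)
    then have "unital_star_hom A U (\<lambda>a. \<Psi> (j a))"
      using \<Psi>(1) by (rule unital_star_hom_compose[OF A.unital_cstar_algebra_axioms])
    moreover have "\<Psi> (j (u r)) = iA (u r)" if "r \<in> carrier (add_monoid R)" for r
      using that iAu_c by (simp add: ju \<Psi>v iP_one U.adj_one)
    ultimately have "\<Psi> (j a) = iA a" if "a \<in> carrier A" for a
      using group_cstar_algebra_hom_eq[OF group_algebra U _ iA _ that] by blast
    then show "\<Psi> (\<Phi> (iA a)) = iA a" if "a \<in> carrier A" for a
      using that by (simp add: \<Phi>(2))
  next
    fix p assume "p \<in> carrier (mult_of R)"
    then have p: "p \<in> carrier R - {\<zero>}" by simp
    have "v (\<zero>, p) \<in> carrier Q" using p v_c by (simp add: opposite_ax_plus_b_simps)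
    then show "\<Psi> (\<Phi> (iP p)) = iP p"
      using p iP_c unital_star_homD(5,6)[OF \<Psi>(1)] unital_star_homD(6)[OF iA]
      by (simp add: \<Phi>(3) \<Psi>v u_zero U.adj_closed U.adj_adj)
  qed
  moreover have "\<Phi> (\<Psi> y) = y" if "y \<in> carrier Q" for y
  proof (rule boundary_quotient_endo_eq_id[OF quotient _ _ _ that])
    show \<Phi>\<Psi>: "unital_star_hom Q Q (\<lambda>y. \<Phi> (\<Psi> y))"
      by (rule unital_star_hom_compose[OF Q \<Psi>(1) \<Phi>(1)])
    show "\<Phi> (\<Psi> (e I)) = e I" if I: "I \<in> constructible_ideals (opposite (ax_plus_b R))" for I
    proof (cases "I = {}")
      case True
      moreover have "e {} = \<zero>\<^bsub>Q\<^esub>" using rel by (simp add: boundary_relations_def)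
      ultimately show ?thesis using unital_star_hom_zero[OF Q Q \<Phi>\<Psi>] by simp
    next
      case False
      then show ?thesis
        using P.boundary_relations_ideal_eq_one[OF Q rel I] unital_star_homD(6)[OF \<Phi>\<Psi>] by simp
    qed
  next
    fix x assume x: "x \<in> carrier (opposite (ax_plus_b R))"
    then obtain r p where rp: "x = (r, p)" "r \<in> carrier R" "p \<in> carrier R - {\<zero>}"
      by (auto simp: opposite_ax_plus_b_simps)
    have c: "v (\<zero>, p) \<in> carrier Q" using rp v_c by (simp add: opposite_ax_plus_b_simps)
    have "v (\<zero>, p) \<otimes>\<^bsub>Q\<^esub> v (r, \<one>) = v ((\<zero>, p) \<otimes>\<^bsub>opposite (ax_plus_b R)\<^esub> (r, \<one>))"
      using rel rp by (simp add: boundary_relations_def opposite_ax_plus_b_simps(1))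
    also have "(\<zero>, p) \<otimes>\<^bsub>opposite (ax_plus_b R)\<^esub> (r, \<one>) = x"
      using rp by (simp add: opposite_ax_plus_b_simps)
    finally show "\<Phi> (\<Psi> (v x)) = v x"
      using rp c iP_c iAu_c unital_star_homD(3,5)[OF \<Phi>(1)]
      by (simp add: \<Psi>v \<Phi> ju u_closed U.adj_closed Q.adj_adj)
  qed
  ultimately show thesis
    using inverse_homs_imp_isomorphic[OF \<Phi>(1) \<Psi>(1)] that \<Phi>(1) by blast
qed

end

theorem mainTheorem2:
  fixes R :: "('r, 'm) ring_scheme"
    and A U Q :: "'c cstar"
    and u :: "'r \<Rightarrow> 'c"
    and \<alpha> :: "'r \<Rightarrow> 'c \<Rightarrow> 'c"
    and iA :: "'c \<Rightarrow> 'c" and iP :: "'r \<Rightarrow> 'c"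
    and v :: "'r \<times> 'r \<Rightarrow> 'c" and e :: "('r \<times> 'r) set \<Rightarrow> 'c"
  assumes "domain R" and "countable (carrier R)"
    and "group_cstar_algebra (add_monoid R) A u"
    and "endo_action (mult_of R) A \<alpha>"
    and "\<And>p r. p \<in> carrier (mult_of R) \<Longrightarrow> r \<in> carrier R \<Longrightarrow> \<alpha> p (u r) = u (p \<otimes>\<^bsub>R\<^esub> r)"
    and "crossed_product (mult_of R) A \<alpha> U iA iP"
    and "boundary_quotient (opposite (ax_plus_b R)) Q v e"
  shows "(\<exists>\<Phi>. unital_star_hom U Q \<Phi> \<and> \<Phi> ` carrier U = carrier Q) \<and>
         (gcd_domain R \<longrightarrow> cstar_isomorphic U Q)"
proof -
  interpret domain_cstar_action R A u \<alpha>
    using assms by (simp add: domain_cstar_action_def domain_cstar_action_axioms_def)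
  obtain \<Phi> where "unital_star_hom U Q \<Phi>" "bij_betw \<Phi> (carrier U) (carrier Q)"
    using crossed_product_iso_boundary_quotient[OF assms(6,7)] .
  then show ?thesis
    by (auto simp: cstar_isomorphic_def bij_betw_def)
qed

end
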